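(* Let $(X,d,\mu)$ be a differentiability space. Then every porous set $S\subset X$ is $\mu$-null.
   Context: Throughout, $(X,d)$ is a complete separable metric space equipped with a locally finite Borel measure $\mu$. A chart of dimension $n\in\mathbb{N}$ is a pair $(U,\varphi)$ with $U\subset X$ Borel and $\varphi\colon X\to\mathbb{R}^n$ Lipschitz. A function $f\colon X\to\mathbb{R}$ is differentiable with respect to $(U,\varphi)$ at $x_0\in U$ if there exists a unique $df(x_0)\in\mathbb{R}^n$ such that \[\limsup_{X\ni x\to x_0}\frac{|f(x)-f(x_0)-df(x_0)\cdot(\varphi(x)-\varphi(x_0))|}{d(x,x_0)}=0\] (limit over $x\ne x_0$). $(X,d,\mu)$ is a differentiability space (also called a Lipschitz differentiability space) if there is a countable decomposition of $X$ into charts such that every Lipschitz $f\colon X\to\mathbb{R}$ is differentiable at almost every point of every chart. For $\eta>0$, a set $S\subset X$ is $\eta$-porous at $x_0\in S$ if there exist $x_n\in X$ with $x_n\to x_0$ and $d(x_n,S)>\eta\, d(x_n,x_0)$ for all $n$, where $d(x,S)=\inf_{s\in S}d(x,s)$. $S$ is porous if for each $x_0\in S$ there is some $\eta>0$ (possibly depending on $x_0$) such that $S$ is $\eta$-porous at $x_0$. A set is $\mu$-null if it is contained in a Borel set of $\mu$-measure zero. *)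

theory Defs
  imports "HOL-Analysis.Analysis"
begin

definition locally_finite_measure :: "'a::topological_space measure \<Rightarrow> bool" where
  "locally_finite_measure \<mu> \<longleftrightarrow> (\<forall>x. \<exists>V. open V \<and> x \<in> V \<and> emeasure \<mu> V < \<infinity>)"

text \<open>The dimension of a chart varies from chart to chart within a single space, so it cannot be
  a type. Elements of \<open>R^n\<close> are therefore functions of type \<^typ>\<open>nat \<Rightarrow> real\<close> in
  \<^term>\<open>topspace (Euclidean_space n)\<close>, i.e. vanishing at all indices \<open>i \<ge> n\<close>; their
  Euclidean norm is \<^const>\<open>L2_set\<close> over \<^term>\<open>{..<n}\<close>.\<close>

definition is_chart :: "nat \<Rightarrow> 'a::metric_space set \<Rightarrow> ('a \<Rightarrow> nat \<Rightarrow> real) \<Rightarrow> bool" where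
  "is_chart n U \<phi> \<longleftrightarrow>
     U \<in> sets borel \<and>
     range \<phi> \<subseteq> topspace (Euclidean_space n) \<and>
     (\<exists>L. \<forall>x y. L2_set (\<lambda>i. \<phi> x i - \<phi> y i) {..<n} \<le> L * dist x y)"

text \<open>The filter \<^term>\<open>at x0\<close> excludes \<open>x0\<close> itself. The limsup is taken in the
  extended nonnegative reals, so at an isolated point it is \<open>0\<close> (the supremum of the
  empty set in \<open>[0, \<infinity>]\<close>) for every candidate \<open>v\<close>; there uniqueness fails
  unless \<open>n = 0\<close>.\<close>

definition is_differential ::
  "nat \<Rightarrow> ('a::metric_space \<Rightarrow> nat \<Rightarrow> real) \<Rightarrow> ('a \<Rightarrow> real) \<Rightarrow> 'a \<Rightarrow> (nat \<Rightarrow> real) \<Rightarrow> bool" where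
  "is_differential n \<phi> f x0 v \<longleftrightarrow>
     v \<in> topspace (Euclidean_space n) \<and>
     Limsup (at x0) (\<lambda>x. ennreal
       (\<bar>f x - f x0 - (\<Sum>i<n. v i * (\<phi> x i - \<phi> x0 i))\<bar> / dist x x0)) = 0"

definition differentiable_wrt ::
  "nat \<Rightarrow> ('a::metric_space \<Rightarrow> nat \<Rightarrow> real) \<Rightarrow> ('a \<Rightarrow> real) \<Rightarrow> 'a \<Rightarrow> bool" where
  "differentiable_wrt n \<phi> f x0 \<longleftrightarrow> (\<exists>!v. is_differential n \<phi> f x0 v)"

text \<open>Finite decompositions are included, since \<open>U i\<close> may be empty.\<close>

definition differentiability_space :: "'a::metric_space measure \<Rightarrow> bool" where
  "differentiability_space \<mu> \<longleftrightarrow>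
     (\<exists>(n :: nat \<Rightarrow> nat) (U :: nat \<Rightarrow> 'a set) (\<phi> :: nat \<Rightarrow> 'a \<Rightarrow> nat \<Rightarrow> real).
        (\<forall>i. is_chart (n i) (U i) (\<phi> i)) \<and>
        disjoint_family U \<and> (\<Union>i. U i) = UNIV \<and>
        (\<forall>f :: 'a \<Rightarrow> real. (\<exists>L. L-lipschitz_on UNIV f) \<longrightarrow>
           (\<forall>i. AE x in \<mu>. x \<in> U i \<longrightarrow> differentiable_wrt (n i) (\<phi> i) f x)))"

definition porous_at :: "real \<Rightarrow> 'a::metric_space set \<Rightarrow> 'a \<Rightarrow> bool" where
  "porous_at \<eta> S x0 \<longleftrightarrow>
     (\<exists>x :: nat \<Rightarrow> 'a. x \<longlonglongrightarrow> x0 \<and> (\<forall>k. infdist (x k) S > \<eta> * dist (x k) x0))"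

definition porous :: "'a::metric_space set \<Rightarrow> bool" where
  "porous S \<longleftrightarrow> (\<forall>x0\<in>S. \<exists>\<eta>>0. porous_at \<eta> S x0)"

end

theory Submission
  imports Defs
begin

text \<open>
  A porous set \<open>S\<close> is a countable union of sets with a uniform porosity constant \<open>\<eta>\<close>, and it
  suffices to work inside an open set \<open>V\<close> of finite measure. For each such piece there is a single
  sequence of Lipschitz functions \<open>f 0, f 1, f 2, \<dots>\<close> that vanish on \<open>S\<close>, have disjoint supports,
  and such that at almost every \<open>x0 \<in> S \<inter> V\<close> every \<open>f j\<close> is at least \<open>(\<eta>/2) d(x,x0)\<close> at some points
  \<open>x\<close> arbitrarily near \<open>x0\<close>.

  Such a family defeats every chart, whatever its dimension \<open>n\<close>. If \<open>f 0, \<dots>, f n\<close> all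
  had differentials at \<open>x0\<close>, these \<open>n + 1\<close> vectors of \<open>R^n\<close> would be linearly dependent, so a
  nontrivial combination \<open>\<Sum>j\<le>n. c j * f j\<close> would be \<open>o(d(x,x0))\<close>. But for \<open>c k \<noteq> 0\<close>
  there are points near \<open>x0\<close> at which only \<open>f k\<close> is nonzero, and there the combination is at
  least \<open>\<bar>c k\<bar> (\<eta>/2) d(x,x0)\<close>. This is \<open>not_all_differentiable\<close>. Since in a differentiability
  space all \<open>f j\<close> are differentiable at almost every point, \<open>S \<inter> V\<close> is null.

  For the construction of the family, cut the half-line of values of \<open>d(x,S)\<close> into
  consecutive blocks \<open>(a (p+1), a p)\<close> with \<open>a p\<close> decreasing to \<open>0\<close>, deal the blocks out to the
  indices \<open>j\<close> so that each index receives infinitely many, and let \<open>f j\<close> be the distance from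
  \<open>d(x,S)\<close> to the complement of the blocks of \<open>j\<close>. The cut points are chosen greedily: once \<open>a p\<close>
  is fixed, every point of \<open>S\<close> sees a hole of some positive size below \<open>a p / 2\<close>, so continuity of
  the measure gives an \<open>a (p+1)\<close> for which all points of \<open>V\<close> that see such a hole, up to
  measure \<open>2^-p\<close>, see one of size between \<open>2 * a (p+1)\<close> and \<open>a p / 2\<close> (\<open>block_boundaries\<close>). By
  Borel--Cantelli, almost every point of \<open>S \<inter> V\<close> sees a hole in all but finitely many blocks.
\<close>

section \<open>A family of functions with no common point of differentiability\<close>

lemma is_differential_eventually:
  assumes "is_differential n \<phi> f x0 v" "0 < \<epsilon>"
  shows "\<forall>\<^sub>F x in at x0.
    \<bar>f x - f x0 - (\<Sum>i<n. v i * (\<phi> x i - \<phi> x0 i))\<bar> \<le> \<epsilon> * dist x x0"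
proof -
  have "Limsup (at x0) (\<lambda>x. ennreal
       (\<bar>f x - f x0 - (\<Sum>i<n. v i * (\<phi> x i - \<phi> x0 i))\<bar> / dist x x0)) < ennreal \<epsilon>"
    using assms by (simp add: is_differential_def)
  from Limsup_lessD[OF this] have "\<forall>\<^sub>F x in at x0. ennreal
       (\<bar>f x - f x0 - (\<Sum>i<n. v i * (\<phi> x i - \<phi> x0 i))\<bar> / dist x x0) < ennreal \<epsilon>" .
  moreover have "\<forall>\<^sub>F x in at x0. x \<noteq> x0"
    by (simp add: eventually_at_filter)
  ultimately show ?thesis
  proof eventually_elim
    case (elim x)
    then show ?case
      by (simp add: ennreal_less_iff pos_divide_less_eq)
  qed
qed

text \<open>Gaussian elimination, one coordinate per induction step: either the last coordinate is
  zero throughout, or some vector with nonzero last coordinate is used to clear that coordinate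
  in all the others.\<close>

lemma linear_dependence:
  fixes v :: "'b \<Rightarrow> nat \<Rightarrow> real"
  assumes "finite J" "n < card J"
  shows "\<exists>c. (\<exists>k\<in>J. c k \<noteq> 0) \<and> (\<forall>i<n. (\<Sum>j\<in>J. c j * v j i) = 0)"
  using assms
proof (induction n arbitrary: J v)
  case 0
  then have "J \<noteq> {}" by auto
  then show ?case by (intro exI[of _ "\<lambda>_. 1"]) auto
next
  case (Suc n)
  show ?case
  proof (cases "\<forall>j\<in>J. v j n = 0")
    case True
    obtain c where c: "\<exists>k\<in>J. c k \<noteq> 0" "\<forall>i<n. (\<Sum>j\<in>J. c j * v j i) = 0"
      using Suc.IH[of J v] Suc.prems by auto
    have "\<forall>i<Suc n. (\<Sum>j\<in>J. c j * v j i) = 0"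
      using c(2) True by (auto simp: less_Suc_eq)
    then show ?thesis using c(1) by blast
  next
    case False
    then obtain k where k: "k \<in> J" "v k n \<noteq> 0" by auto
    define r where "r j = v j n / v k n" for j
    have "\<exists>c. (\<exists>k\<in>J - {k}. c k \<noteq> 0) \<and>
        (\<forall>i<n. (\<Sum>j\<in>J - {k}. c j * (v j i - r j * v k i)) = 0)"
      using Suc.prems k(1) by (intro Suc.IH) (auto simp: card_Diff_singleton)
    then obtain c where c: "\<exists>k\<in>J - {k}. c k \<noteq> 0"
        "\<forall>i<n. (\<Sum>j\<in>J - {k}. c j * (v j i - r j * v k i)) = 0" by blast
    define c' where "c' = c(k := - (\<Sum>j\<in>J - {k}. c j * r j))"
    have sum_c': "(\<Sum>j\<in>J. c' j * v j i) = (\<Sum>j\<in>J - {k}. c j * (v j i - r j * v k i))" for i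
    proof -
      have "(\<Sum>j\<in>J. c' j * v j i) = c' k * v k i + (\<Sum>j\<in>J - {k}. c' j * v j i)"
        using Suc.prems(1) k(1) by (rule sum.remove)
      also have "(\<Sum>j\<in>J - {k}. c' j * v j i) = (\<Sum>j\<in>J - {k}. c j * v j i)"
        by (intro sum.cong) (auto simp: c'_def)
      also have "c' k * v k i = - (\<Sum>j\<in>J - {k}. c j * r j * v k i)"
        by (simp add: c'_def sum_distrib_right)
      finally show ?thesis
        by (simp add: right_diff_distrib sum_subtractf mult.assoc)
    qed
    have "(\<Sum>j\<in>J - {k}. c j * (v j n - r j * v k n)) = 0"
      using k(2) by (simp add: r_def)
    then have "\<forall>i<Suc n. (\<Sum>j\<in>J. c' j * v j i) = 0"
      unfolding sum_c' using c(2) by (auto simp: less_Suc_eq)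
    moreover have "\<exists>k\<in>J. c' k \<noteq> 0"
      using c(1) by (auto simp: c'_def)
    ultimately show ?thesis by blast
  qed
qed

lemma not_all_differentiable:
  fixes f :: "nat \<Rightarrow> 'a::metric_space \<Rightarrow> real"
  assumes "0 < \<kappa>"
    and vanish: "\<And>j. f j x0 = 0"
    and large: "\<And>j. \<exists>\<^sub>F x in at x0. \<kappa> * dist x x0 \<le> f j x \<and> (\<forall>i. i \<noteq> j \<longrightarrow> f i x = 0)"
  shows "\<exists>j\<le>n. \<not> differentiable_wrt n \<phi> (f j) x0"
proof (rule ccontr)
  assume "\<not> ?thesis"
  then have "\<forall>j\<le>n. \<exists>v. is_differential n \<phi> (f j) x0 v"
    by (auto simp: differentiable_wrt_def)
  then obtain D where D: "\<And>j. j \<le> n \<Longrightarrow> is_differential n \<phi> (f j) x0 (D j)"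
    by metis
  obtain c k where k: "k \<le> n" "c k \<noteq> 0"
    and dep: "\<And>i. i < n \<Longrightarrow> (\<Sum>j\<le>n. c j * D j i) = 0"
    using linear_dependence[of "{..n}" n D] by auto
  define C where "C = (\<Sum>j\<le>n. \<bar>c j\<bar>)"
  have "\<bar>c k\<bar> \<le> C"
    unfolding C_def using k(1) by (intro member_le_sum) auto
  then have "0 < C" using k(2) by auto
  define \<epsilon> where "\<epsilon> = \<bar>c k\<bar> * \<kappa> / (2 * C)"
  have "0 < \<epsilon>" using \<open>0 < C\<close> \<open>0 < \<kappa>\<close> k(2) by (simp add: \<epsilon>_def)
  have "\<forall>\<^sub>F x in at x0. \<forall>j\<in>{..n}.
      \<bar>f j x - f j x0 - (\<Sum>i<n. D j i * (\<phi> x i - \<phi> x0 i))\<bar> \<le> \<epsilon> * dist x x0"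
    using D \<open>0 < \<epsilon>\<close> by (intro eventually_ball_finite ballI is_differential_eventually) auto
  moreover have "\<forall>\<^sub>F x in at x0. x \<noteq> x0"
    by (simp add: eventually_at_filter)
  ultimately have "\<forall>\<^sub>F x in at x0. (\<forall>j\<in>{..n}.
      \<bar>f j x - f j x0 - (\<Sum>i<n. D j i * (\<phi> x i - \<phi> x0 i))\<bar> \<le> \<epsilon> * dist x x0) \<and> x \<noteq> x0"
    by (rule eventually_conj)
  note frequently_ex[OF frequently_eventually_frequently[OF large[of k] this]]
  then obtain x where "x \<noteq> x0" and x: "\<kappa> * dist x x0 \<le> f k x" "\<And>i. i \<noteq> k \<Longrightarrow> f i x = 0"
    and err: "\<And>j. j \<le> n \<Longrightarrow>
      \<bar>f j x - (\<Sum>i<n. D j i * (\<phi> x i - \<phi> x0 i))\<bar> \<le> \<epsilon> * dist x x0"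
    using vanish by auto
  have lin: "(\<Sum>j\<le>n. c j * (\<Sum>i<n. D j i * (\<phi> x i - \<phi> x0 i))) = 0"
  proof -
    have "(\<Sum>j\<le>n. c j * (\<Sum>i<n. D j i * (\<phi> x i - \<phi> x0 i)))
        = (\<Sum>i<n. \<Sum>j\<le>n. c j * D j i * (\<phi> x i - \<phi> x0 i))"
      by (subst sum.swap) (simp add: sum_distrib_left mult.assoc)
    also have "\<dots> = (\<Sum>i<n. (\<Sum>j\<le>n. c j * D j i) * (\<phi> x i - \<phi> x0 i))"
      by (simp add: sum_distrib_right)
    also have "\<dots> = 0" using dep by simp
    finally show ?thesis .
  qed
  have "\<bar>c k\<bar> * (\<kappa> * dist x x0) \<le> \<bar>c k\<bar> * f k x"
    using x(1) by (intro mult_left_mono) auto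
  also have "\<dots> \<le> \<bar>c k * f k x\<bar>"
    by (simp add: abs_mult mult_left_mono)
  also have "c k * f k x = (\<Sum>j\<le>n. c j * f j x)"
  proof -
    have "(\<Sum>j\<le>n. c j * f j x) = (\<Sum>j\<in>{k}. c j * f j x)"
      using k(1) x(2) by (intro sum.mono_neutral_right) auto
    then show ?thesis by simp
  qed
  also have "\<dots> = (\<Sum>j\<le>n. c j * (f j x - (\<Sum>i<n. D j i * (\<phi> x i - \<phi> x0 i))))"
    using lin by (simp add: right_diff_distrib sum_subtractf)
  also have "\<bar>\<dots>\<bar> \<le> (\<Sum>j\<le>n. \<bar>c j\<bar> * (\<epsilon> * dist x x0))"
    using err by (intro order_trans[OF sum_abs] sum_mono) (auto simp: abs_mult intro!: mult_left_mono)
  also have "\<dots> = C * \<epsilon> * dist x x0"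
    by (simp add: C_def sum_distrib_right mult.assoc)
  also have "\<dots> = \<bar>c k\<bar> * \<kappa> * dist x x0 / 2"
    using \<open>0 < C\<close> by (simp add: \<epsilon>_def)
  finally have "\<bar>c k\<bar> * \<kappa> * dist x x0 \<le> \<bar>c k\<bar> * \<kappa> * dist x x0 / 2"
    by (simp add: mult.assoc)
  moreover have "0 < \<bar>c k\<bar> * \<kappa> * dist x x0"
    using k(2) \<open>0 < \<kappa>\<close> \<open>x \<noteq> x0\<close> by simp
  ultimately show False by linarith
qed

section \<open>Holes of a prescribed size\<close>

lemma porous_at_mono:
  assumes "porous_at \<eta> S x0" "\<eta>' \<le> \<eta>" "T \<subseteq> S" "T \<noteq> {}"
  shows "porous_at \<eta>' T x0"
proof -
  obtain x where x: "x \<longlonglongrightarrow> x0" "\<And>k. infdist (x k) S > \<eta> * dist (x k) x0"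
    using assms(1) by (auto simp: porous_at_def)
  have "\<eta>' * dist (x k) x0 < infdist (x k) T" for k
  proof -
    have "\<eta>' * dist (x k) x0 \<le> \<eta> * dist (x k) x0"
      using assms(2) by (intro mult_right_mono) auto
    also have "\<dots> < infdist (x k) S"
      by (rule x(2))
    also have "\<dots> \<le> infdist (x k) T"
      using assms(3,4) by (rule infdist_mono)
    finally show ?thesis .
  qed
  with x(1) show ?thesis
    by (auto simp: porous_at_def)
qed

text \<open>The points that see, within the aperture fixed by \<open>\<eta>\<close>, a hole of \<open>S\<close> whose size lies
  strictly between \<open>s\<close> and \<open>r\<close>. Taking all such points of the space, rather than those of \<open>S\<close>,
  gives an open set, hence a measurable one, for an arbitrary \<open>S\<close>.\<close>

definition hole_shadow :: "'a::metric_space set \<Rightarrow> real \<Rightarrow> real \<Rightarrow> real \<Rightarrow> 'a set" where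
  "hole_shadow S \<eta> s r = (\<Union>x\<in>{x. s < infdist x S \<and> infdist x S < r}. ball x (infdist x S / \<eta>))"

lemma open_hole_shadow: "open (hole_shadow S \<eta> s r)"
  by (auto simp: hole_shadow_def)

lemma hole_shadow_mono: "s' \<le> s \<Longrightarrow> hole_shadow S \<eta> s r \<subseteq> hole_shadow S \<eta> s' r"
  by (force simp: hole_shadow_def)

lemma porous_at_hole_shadow:
  assumes "porous_at \<eta> S x0" "x0 \<in> S" "0 < \<eta>" "0 < r"
  shows "x0 \<in> hole_shadow S \<eta> 0 r"
proof -
  obtain x where x: "x \<longlonglongrightarrow> x0" "\<And>k. infdist (x k) S > \<eta> * dist (x k) x0"
    using assms(1) by (auto simp: porous_at_def)
  obtain k where k: "dist (x k) x0 < r"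
    using tendstoD[OF x(1) \<open>0 < r\<close>] by (auto simp: eventually_sequentially)
  have "infdist (x k) S < r"
    using infdist_le[OF \<open>x0 \<in> S\<close>, of "x k"] k by simp
  moreover have "0 \<le> \<eta> * dist (x k) x0"
    using \<open>0 < \<eta>\<close> by simp
  then have "0 < infdist (x k) S"
    using x(2)[of k] by linarith
  moreover have "dist (x k) x0 < infdist (x k) S / \<eta>"
    using x(2)[of k] \<open>0 < \<eta>\<close> by (simp add: pos_less_divide_eq mult.commute)
  ultimately show ?thesis
    by (auto simp: hole_shadow_def)
qed

lemma hole_shadow_exhaustion:
  assumes "sets \<mu> = sets borel" "open V" "emeasure \<mu> V < \<infinity>" "0 < \<epsilon>"
  shows "\<exists>s>0. emeasure \<mu> (V \<inter> hole_shadow S \<eta> 0 r - hole_shadow S \<eta> s r) < \<epsilon>"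
proof -
  define s :: "nat \<Rightarrow> real" where "s k = inverse (real (Suc k))" for k
  define A where "A k = V \<inter> hole_shadow S \<eta> 0 r - hole_shadow S \<eta> (s k) r" for k
  have sets_A: "A k \<in> sets \<mu>" for k
    unfolding A_def assms(1) using assms(2)
    by (intro sets.Diff borel_open open_Int open_hole_shadow)
  have "V \<in> sets \<mu>"
    using assms(1,2) by simp
  then have "emeasure \<mu> (A k) \<le> emeasure \<mu> V" for k
    by (intro emeasure_mono) (auto simp: A_def)
  then have fin: "emeasure \<mu> (A k) \<noteq> \<infinity>" for k
    using assms(3) by (metis infinity_ennreal_def linorder_not_le top.not_eq_extremum)
  have "s k' \<le> s k" if "k \<le> k'" for k k'
    using that by (simp add: s_def field_simps)
  then have "decseq A"
    unfolding decseq_def A_def using hole_shadow_mono by blast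
  have "(\<Inter>k. A k) = {}"
  proof (rule equals0I)
    fix y assume y: "y \<in> (\<Inter>k. A k)"
    then obtain x where x: "0 < infdist x S" "infdist x S < r" "y \<in> ball x (infdist x S / \<eta>)"
      by (auto simp: A_def hole_shadow_def)
    obtain k where "s k < infdist x S"
      using reals_Archimedean[OF x(1)] by (auto simp: s_def)
    then have "y \<in> hole_shadow S \<eta> (s k) r"
      using x by (auto simp: hole_shadow_def)
    then show False
      using y by (auto simp: A_def)
  qed
  then have "(\<lambda>k. emeasure \<mu> (A k)) \<longlonglongrightarrow> 0"
    using Lim_emeasure_decseq[of A \<mu>] sets_A \<open>decseq A\<close> fin by auto
  then have "\<forall>\<^sub>F k in sequentially. emeasure \<mu> (A k) < \<epsilon>"
    using \<open>0 < \<epsilon>\<close> by (rule order_tendstoD)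
  then obtain k where "emeasure \<mu> (A k) < \<epsilon>"
    by (auto simp: eventually_sequentially)
  moreover have "0 < s k"
    by (simp add: s_def)
  ultimately show ?thesis
    unfolding A_def by blast
qed

text \<open>The factors \<open>2\<close> and \<open>1/2\<close> keep the hole sizes away from the ends of the block, where the
  functions built from the blocks are small.\<close>

lemma block_boundaries:
  fixes S V :: "'a::metric_space set"
  assumes "sets \<mu> = sets borel" "open V" "emeasure \<mu> V < \<infinity>"
  obtains a :: "nat \<Rightarrow> real" where "\<And>p. 0 < a p" "decseq a" "a \<longlonglongrightarrow> 0"
    "AE x in \<mu>. x \<in> V \<longrightarrow> (\<forall>\<^sub>F p in sequentially.
       x \<in> hole_shadow S \<eta> 0 (a p / 2) \<longrightarrow> x \<in> hole_shadow S \<eta> (2 * a (Suc p)) (a p / 2))"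
proof -
  define N where
    "N b b' = V \<inter> hole_shadow S \<eta> 0 (b / 2) - hole_shadow S \<eta> (2 * b') (b / 2)" for b b' :: real
  have sets_diff: "V \<inter> hole_shadow S \<eta> q r - hole_shadow S \<eta> s r \<in> sets \<mu>" for q r s
    unfolding assms(1) using assms(2) by (intro sets.Diff borel_open open_Int open_hole_shadow)
  have "\<exists>b'. (0 < b' \<and> b' \<le> (1/2) ^ Suc p) \<and> b' \<le> b \<and> emeasure \<mu> (N b b') \<le> ennreal ((1/2) ^ p)"
    if b: "0 < b \<and> b \<le> (1/2) ^ p" for b :: real and p
  proof -
    obtain s where s: "0 < s" and
      less: "emeasure \<mu> (V \<inter> hole_shadow S \<eta> 0 (b / 2) - hole_shadow S \<eta> s (b / 2)) < ennreal ((1/2) ^ p)"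
      using hole_shadow_exhaustion[OF assms, of "ennreal ((1/2) ^ p)" S \<eta> "b / 2"] by auto
    define b' where "b' = min (s / 2) (b / 2)"
    have "hole_shadow S \<eta> s (b / 2) \<subseteq> hole_shadow S \<eta> (2 * b') (b / 2)"
      by (intro hole_shadow_mono) (auto simp: b'_def)
    then have "emeasure \<mu> (N b b') \<le>
        emeasure \<mu> (V \<inter> hole_shadow S \<eta> 0 (b / 2) - hole_shadow S \<eta> s (b / 2))"
      unfolding N_def by (intro emeasure_mono sets_diff) auto
    with less have "emeasure \<mu> (N b b') \<le> ennreal ((1/2) ^ p)"
      by order
    moreover have "0 < b'" "b' \<le> b" "b' \<le> (1/2) ^ Suc p"
      using s b by (auto simp: b'_def)
    ultimately show ?thesis by blast
  qed
  moreover have "\<exists>b::real. 0 < b \<and> b \<le> (1/2) ^ 0"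
    by (intro exI[of _ 1]) simp
  ultimately obtain a :: "nat \<Rightarrow> real" where a: "\<And>p. 0 < a p" "\<And>p. a p \<le> (1/2) ^ p"
    "\<And>p. a (Suc p) \<le> a p" "\<And>p. emeasure \<mu> (N (a p) (a (Suc p))) \<le> ennreal ((1/2) ^ p)"
    using dependent_nat_choice[of "\<lambda>p b. 0 < b \<and> b \<le> (1/2) ^ p"
        "\<lambda>p b b'. b' \<le> b \<and> emeasure \<mu> (N b b') \<le> ennreal ((1/2) ^ p)"] by metis
  have "decseq a"
    using a(3) by (rule decseq_SucI)
  have "a \<longlonglongrightarrow> 0"
  proof (rule real_tendsto_sandwich)
    show "\<forall>\<^sub>F p in sequentially. 0 \<le> a p" "\<forall>\<^sub>F p in sequentially. a p \<le> (1/2) ^ p"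
      using a(2) by (simp_all add: less_imp_le[OF a(1)])
    show "(\<lambda>p. (1/2::real) ^ p) \<longlonglongrightarrow> 0"
      by (rule LIMSEQ_power_zero) simp
  qed (rule tendsto_const)
  have "AE x in \<mu>. \<forall>\<^sub>F p in sequentially. x \<in> space \<mu> - N (a p) (a (Suc p))"
  proof (rule borel_cantelli_AE1)
    show "N (a p) (a (Suc p)) \<in> sets \<mu>" for p
      unfolding N_def by (rule sets_diff)
    show "emeasure \<mu> (N (a p) (a (Suc p))) < \<infinity>" for p
      using a(4)[of p] by (simp add: le_less_trans)
    have "summable (\<lambda>p. (1/2::real) ^ p)"
      by (rule summable_geometric) simp
    then show "summable (\<lambda>p. measure \<mu> (N (a p) (a (Suc p))))"
    proof (rule summable_comparison_test'[where N = 0])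
      show "norm (measure \<mu> (N (a p) (a (Suc p)))) \<le> (1/2) ^ p" for p
        using a(4)[of p] by (simp add: measure_def enn2real_leI)
    qed
  qed
  then have "AE x in \<mu>. x \<in> V \<longrightarrow> (\<forall>\<^sub>F p in sequentially.
       x \<in> hole_shadow S \<eta> 0 (a p / 2) \<longrightarrow> x \<in> hole_shadow S \<eta> (2 * a (Suc p)) (a p / 2))"
  proof eventually_elim
    case (elim x)
    show ?case
    proof
      assume "x \<in> V"
      from elim show "\<forall>\<^sub>F p in sequentially.
         x \<in> hole_shadow S \<eta> 0 (a p / 2) \<longrightarrow> x \<in> hole_shadow S \<eta> (2 * a (Suc p)) (a p / 2)"
        by (rule eventually_mono) (use \<open>x \<in> V\<close> in \<open>simp add: N_def\<close>)
    qed
  qed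
  with that a(1) \<open>decseq a\<close> \<open>a \<longlonglongrightarrow> 0\<close> show ?thesis by blast
qed

section \<open>Functions supported on disjoint families of blocks\<close>

text \<open>Pairing distributes the blocks so that every index \<open>j\<close> owns infinitely many of them.\<close>

definition blocks :: "(nat \<Rightarrow> real) \<Rightarrow> nat \<Rightarrow> real set" where
  "blocks a j = (\<Union>m. {a (Suc (prod_encode (j, m))) <..< a (prod_encode (j, m))})"

definition block_fun :: "'a::metric_space set \<Rightarrow> (nat \<Rightarrow> real) \<Rightarrow> nat \<Rightarrow> 'a \<Rightarrow> real" where
  "block_fun S a j x = infdist (infdist x S) (- blocks a j)"

lemma block_fun_lipschitz: "1-lipschitz_on UNIV (block_fun S a j)"
proof (rule lipschitz_onI)
  fix x y
  have "dist (block_fun S a j x) (block_fun S a j y) \<le> dist (infdist x S) (infdist y S)"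
    using infdist_triangle_abs[of "infdist x S" _ "infdist y S"]
    by (simp add: block_fun_def dist_real_def)
  also have "\<dots> \<le> dist x y"
    by (simp add: dist_real_def infdist_triangle_abs)
  finally show "dist (block_fun S a j x) (block_fun S a j y) \<le> 1 * dist x y"
    by simp
qed simp

lemma block_fun_eq_0: "infdist x S \<notin> blocks a j \<Longrightarrow> block_fun S a j x = 0"
  by (simp add: block_fun_def)

lemma zero_notin_blocks: "(\<And>p. 0 < a p) \<Longrightarrow> 0 \<notin> blocks a j"
  by (simp add: blocks_def not_less less_imp_le)

lemma blocks_disjoint:
  assumes "decseq a" "t \<in> blocks a i" "t \<in> blocks a j"
  shows "i = j"
proof -
  obtain m m' where t:
    "a (Suc (prod_encode (i, m))) < t" "t < a (prod_encode (i, m))"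
    "a (Suc (prod_encode (j, m'))) < t" "t < a (prod_encode (j, m'))"
    using assms(2,3) by (auto simp: blocks_def)
  have "q \<le> p" if "a (Suc p) < t" "t < a q" for p q
  proof (rule ccontr)
    assume "\<not> q \<le> p"
    then have "a q \<le> a (Suc p)"
      using \<open>decseq a\<close> by (simp add: decseq_def)
    with that show False by simp
  qed
  with t have "prod_encode (i, m) = prod_encode (j, m')"
    by (meson order_antisym)
  then show ?thesis by simp
qed

lemma block_fun_large:
  fixes m :: nat
  assumes pos: "\<And>p. 0 < a p" and p: "p = prod_encode (j, m)"
    and t: "2 * a (Suc p) < infdist x S" "infdist x S < a p / 2"
  shows "infdist x S / 2 \<le> block_fun S a j x"
proof -
  have "infdist x S / 2 \<le> dist (infdist x S) y" if "y \<in> - blocks a j" for y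
  proof -
    have "y \<le> a (Suc p) \<or> a p \<le> y"
      using that unfolding p blocks_def by (simp add: not_less)
    then show ?thesis
      using t pos[of "Suc p"] unfolding dist_real_def by linarith
  qed
  moreover have "- blocks a j \<noteq> {}"
    using zero_notin_blocks[of a j] pos by blast
  ultimately show ?thesis
    unfolding block_fun_def infdist_notempty[OF \<open>- blocks a j \<noteq> {}\<close>] by (intro cINF_greatest)
qed

text \<open>Index \<open>j\<close> owns arbitrarily late blocks, and a hole \<open>x\<close> in a late block lies close to \<open>x0\<close>,
  since \<open>d(x,x0) < d(x,S) / \<eta>\<close>. There \<open>f j\<close> is at least half of \<open>d(x,S)\<close>, which gives the constant
  \<open>\<eta> / 2\<close>.\<close>

lemma block_fun_frequently_large:
  assumes pos: "\<And>p. 0 < a p" and "decseq a" "a \<longlonglongrightarrow> 0"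
    and "0 < \<eta>" "x0 \<in> S"
    and sees: "\<forall>\<^sub>F p in sequentially. x0 \<in> hole_shadow S \<eta> (2 * a (Suc p)) (a p / 2)"
  shows "\<exists>\<^sub>F x in at x0. \<eta> / 2 * dist x x0 \<le> block_fun S a j x \<and>
           (\<forall>i. i \<noteq> j \<longrightarrow> block_fun S a i x = 0)"
  unfolding frequently_def eventually_at
proof safe
  fix d :: real
  assume "0 < d" and none: "\<forall>x\<in>UNIV. x \<noteq> x0 \<and> dist x x0 < d \<longrightarrow>
    \<not> (\<eta> / 2 * dist x x0 \<le> block_fun S a j x \<and> (\<forall>i. i \<noteq> j \<longrightarrow> block_fun S a i x = 0))"
  have "\<forall>\<^sub>F p in sequentially. a p < \<eta> * d"
    using \<open>a \<longlonglongrightarrow> 0\<close> \<open>0 < \<eta>\<close> \<open>0 < d\<close> by (intro order_tendstoD) auto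
  with sees have "\<forall>\<^sub>F p in sequentially.
      x0 \<in> hole_shadow S \<eta> (2 * a (Suc p)) (a p / 2) \<and> a p < \<eta> * d"
    by (rule eventually_conj)
  then obtain m where m: "\<And>p. m \<le> p \<Longrightarrow>
      x0 \<in> hole_shadow S \<eta> (2 * a (Suc p)) (a p / 2) \<and> a p < \<eta> * d"
    by (auto simp: eventually_sequentially)
  define p where "p = prod_encode (j, m)"
  have "m \<le> p"
    by (simp add: p_def le_prod_encode_2)
  with m obtain x where x: "2 * a (Suc p) < infdist x S" "infdist x S < a p / 2"
      "dist x x0 < infdist x S / \<eta>" and "a p < \<eta> * d"
    by (auto simp: hole_shadow_def)
  have \<eta>: "\<eta> * dist x x0 < infdist x S"
    using x(3) \<open>0 < \<eta>\<close> by (simp add: pos_less_divide_eq mult.commute)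
  have "0 < infdist x S"
    using x(1) pos[of "Suc p"] by linarith
  then have "x \<noteq> x0"
    using \<open>x0 \<in> S\<close> by auto
  moreover have "\<eta> * dist x x0 < \<eta> * d"
    using \<eta> x(2) \<open>a p < \<eta> * d\<close> pos[of p] by linarith
  then have "dist x x0 < d"
    using \<open>0 < \<eta>\<close> by simp
  moreover have "\<eta> / 2 * dist x x0 \<le> block_fun S a j x"
    using block_fun_large[OF pos p_def x(1,2)] \<eta> by simp
  moreover have "infdist x S \<in> blocks a j"
    unfolding blocks_def using x(1,2) pos[of p] pos[of "Suc p"]
    by (intro UN_I[of m]) (auto simp flip: p_def)
  then have "block_fun S a i x = 0" if "i \<noteq> j" for i
    using that blocks_disjoint[OF \<open>decseq a\<close>] by (intro block_fun_eq_0) blast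
  ultimately show False
    using none by blast
qed

section \<open>Porous sets are null\<close>

lemma AE_notin_uniformly_porous:
  fixes S V :: "'a::metric_space set"
  assumes \<mu>: "sets \<mu> = sets borel" and "differentiability_space \<mu>"
    and V: "open V" "emeasure \<mu> V < \<infinity>"
    and "0 < \<eta>" and por: "\<And>x. x \<in> S \<Longrightarrow> porous_at \<eta> S x"
  shows "AE x in \<mu>. x \<notin> S \<inter> V"
proof -
  obtain n and U :: "nat \<Rightarrow> 'a set" and \<phi> where cover: "(\<Union>i. U i) = UNIV"
    and diff: "\<And>f :: 'a \<Rightarrow> real. \<exists>L. L-lipschitz_on UNIV f \<Longrightarrow>
           \<forall>i. AE x in \<mu>. x \<in> U i \<longrightarrow> differentiable_wrt (n i) (\<phi> i) f x"
    using assms(2) unfolding differentiability_space_def by blast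
  obtain a where a: "\<And>p. 0 < a p" "decseq a" "a \<longlonglongrightarrow> 0"
    and sees: "AE x in \<mu>. x \<in> V \<longrightarrow> (\<forall>\<^sub>F p in sequentially.
       x \<in> hole_shadow S \<eta> 0 (a p / 2) \<longrightarrow> x \<in> hole_shadow S \<eta> (2 * a (Suc p)) (a p / 2))"
    using block_boundaries[OF \<mu> V] by blast
  have "AE x in \<mu>. \<forall>j i. x \<in> U i \<longrightarrow> differentiable_wrt (n i) (\<phi> i) (block_fun S a j) x"
    unfolding AE_all_countable using diff[OF exI, OF block_fun_lipschitz] by simp
  with sees show ?thesis
  proof eventually_elim
    case (elim x0)
    show ?case
    proof
      assume "x0 \<in> S \<inter> V"
      then have "x0 \<in> S" "x0 \<in> V" by auto
      have "x0 \<in> hole_shadow S \<eta> 0 (a p / 2)" for p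
        using a(1)[of p] \<open>0 < \<eta>\<close> \<open>x0 \<in> S\<close> por by (intro porous_at_hole_shadow) auto
      with elim(1) \<open>x0 \<in> V\<close> have
        "\<forall>\<^sub>F p in sequentially. x0 \<in> hole_shadow S \<eta> (2 * a (Suc p)) (a p / 2)"
        by simp
      note large = block_fun_frequently_large[OF a \<open>0 < \<eta>\<close> \<open>x0 \<in> S\<close> this]
      have zero: "block_fun S a j x0 = 0" for j
        using \<open>x0 \<in> S\<close> zero_notin_blocks[of a, OF a(1)] by (intro block_fun_eq_0) simp
      obtain i where "x0 \<in> U i"
        using cover by blast
      moreover obtain j where "\<not> differentiable_wrt (n i) (\<phi> i) (block_fun S a j) x0"
        using not_all_differentiable[of "\<eta> / 2" "block_fun S a" x0, OF _ zero large] \<open>0 < \<eta>\<close>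
        by auto
      ultimately show False
        using elim(2) by blast
    qed
  qed
qed

lemma countable_finite_measure_cover:
  fixes \<mu> :: "'a::second_countable_topology measure"
  assumes "locally_finite_measure \<mu>"
  obtains \<V> where "countable \<V>" "\<Union>\<V> = UNIV" "\<And>V. V \<in> \<V> \<Longrightarrow> open V \<and> emeasure \<mu> V < \<infinity>"
proof -
  define \<F> where "\<F> = {V. open V \<and> emeasure \<mu> V < \<infinity>}"
  obtain \<V> where "\<V> \<subseteq> \<F>" "countable \<V>" "\<Union>\<V> = \<Union>\<F>"
    using Lindelof[of \<F>] by (auto simp: \<F>_def)
  moreover have "\<Union>\<F> = UNIV"
    using assms by (fastforce simp: locally_finite_measure_def \<F>_def)
  ultimately show ?thesis
    using that[of \<V>] by (auto simp: \<F>_def)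
qed

theorem theorem2p4:
  fixes \<mu> :: "'a::polish_space measure" and S :: "'a set"
  assumes "sets \<mu> = sets borel"
    and "locally_finite_measure \<mu>"
    and "differentiability_space \<mu>"
    and "porous S"
  shows "\<exists>B \<in> sets borel. S \<subseteq> B \<and> emeasure \<mu> B = 0"
proof -
  define T where "T m = {x \<in> S. porous_at (inverse (real (Suc m))) S x}" for m
  have "porous_at (inverse (real (Suc m))) (T m) x" if "x \<in> T m" for m x
    by (rule porous_at_mono[of "inverse (real (Suc m))" S x]) (use that in \<open>auto simp: T_def\<close>)
  then have AE_T: "AE x in \<mu>. x \<notin> T m \<inter> V" if "open V" "emeasure \<mu> V < \<infinity>" for m V
    using AE_notin_uniformly_porous[OF assms(1,3) that, of "inverse (real (Suc m))" "T m"] by simp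
  obtain \<V> where \<V>: "countable \<V>" "\<Union>\<V> = (UNIV :: 'a set)"
    "\<And>V. V \<in> \<V> \<Longrightarrow> open V \<and> emeasure \<mu> V < \<infinity>"
    using countable_finite_measure_cover[OF assms(2)] by blast
  have "AE x in \<mu>. \<forall>V\<in>\<V>. \<forall>m. x \<notin> T m \<inter> V"
    unfolding AE_ball_countable[OF \<V>(1)] AE_all_countable using \<V>(3) AE_T by simp
  moreover have "S \<subseteq> (\<Union>m. T m)"
  proof
    fix x assume "x \<in> S"
    with assms(4) obtain \<eta> where \<eta>: "0 < \<eta>" "porous_at \<eta> S x"
      by (auto simp: porous_def)
    obtain m where m: "inverse (real (Suc m)) < \<eta>"
      using reals_Archimedean[OF \<eta>(1)] by auto
    have "porous_at (inverse (real (Suc m))) S x"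
      by (rule porous_at_mono[OF \<eta>(2)]) (use m \<open>x \<in> S\<close> in auto)
    with \<open>x \<in> S\<close> show "x \<in> (\<Union>m. T m)"
      by (auto simp: T_def)
  qed
  ultimately have "AE x in \<mu>. x \<notin> S"
    using \<V>(2) by (auto elim!: eventually_mono)
  then obtain B where B: "{x \<in> space \<mu>. \<not> x \<notin> S} \<subseteq> B" "emeasure \<mu> B = 0" "B \<in> sets \<mu>"
    by (rule AE_E)
  moreover have "space \<mu> = UNIV"
    using sets_eq_imp_space_eq[OF assms(1)] by simp
  ultimately show ?thesis
    using assms(1) by auto
qed

end
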